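(* Let $\mathcal{Q}$ be an $((n,M,d;c))$ entanglement-assisted quantum code with generalized stabilizer sets $\{S_j^{n,c}\}_{j\in[-1,1]}$. Then $$d=\min\Bigl\{\mathrm{wt}(\alpha):\alpha\in\mathcal{E}^n\setminus\bigcup_{j}S_j^{n,c}\Bigr\}.$$
   Context: Let $I,\sigma_x,\sigma_y,\sigma_z$ be the $2\times2$ identity and the Pauli matrices and $\mathcal{E}^m=\{\sigma_1\otimes\cdots\otimes\sigma_m:\sigma_i\in\{I,\sigma_x,\sigma_y,\sigma_z\}\}$. The weight $\mathrm{wt}$ of a Pauli operator is its number of non-identity tensor factors. An operator $E\in\mathcal{E}^{n+c}$ is detectable by a subspace $\mathcal{Q}\subset\mathbb{C}^{2^{n+c}}$ if, for an orthonormal basis $\{|v_i\rangle\}$ of $\mathcal{Q}$, $\langle v_i|E|v_i\rangle=\langle v_j|E|v_j\rangle$ for all $i,j$ and $\langle v_i|E|v_j\rangle=0$ for $i\ne j$. An $((n,M,d;c))$ entanglement-assisted (EA) quantum code is an $M$-dimensional subspace $\mathcal{Q}\subset\mathbb{C}^{2^n}\otimes\mathbb{C}^{2^c}$ such that (1) for every unit vector $|v\rangle\in\mathcal{Q}$, $\mathrm{Tr}_{\mathbb{C}^{2^n}}(|v\rangle\langle v|)=I^{\otimes c}/2^c$; and (2) $\alpha\otimes I^{\otimes c}$ is detectable by $\mathcal{Q}$ for all $\alpha\in\mathcal{E}^n$ of weight at most $d-1$, but not for all $\alpha$ of weight $d$. With $P$ the orthogonal projector onto $\mathcal{Q}$,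 the generalized stabilizer (GS) sets of $\mathcal{Q}$ are, for real $j\in[-1,1]$, $S_j^{n,c}=\{\beta\in\mathcal{E}^n:P(\beta\otimes I^{\otimes c})P=jP\}$. *)

theory Defs
  imports "Jordan_Normal_Form.Schur_Decomposition"
begin

section \<open>Tensor products and partial trace\<close>

text \<open>Matrices and vectors are those of \<^theory>\<open>Jordan_Normal_Form.Matrix\<close>. The space
  \<open>\<complex>\<^sup>a \<otimes> \<complex>\<^sup>b\<close> is identified with \<open>\<complex>\<^sup>a\<^sup>b\<close> through the Kronecker
  ordering: the basis vector \<open>e\<^sub>i \<otimes> e\<^sub>j\<close> has index \<open>i * b + j\<close>.\<close>

definition kron :: "complex mat \<Rightarrow> complex mat \<Rightarrow> complex mat" (infixr \<open>\<otimes>\<^sub>k\<close> 72) where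
  "A \<otimes>\<^sub>k B = mat (dim_row A * dim_row B) (dim_col A * dim_col B)
     (\<lambda>(i, j). A $$ (i div dim_row B, j div dim_col B) * B $$ (i mod dim_row B, j mod dim_col B))"

definition ketbra :: "complex vec \<Rightarrow> complex vec \<Rightarrow> complex mat" where
  "ketbra v w = mat (dim_vec v) (dim_vec w) (\<lambda>(i, j). v $ i * cnj (w $ j))"

text \<open>In \<^term>\<open>u \<bullet>c v\<close> the second argument is conjugated, so the physicists' \<open>\<langle>v|u\<rangle>\<close>
  is \<^term>\<open>u \<bullet>c v\<close>.\<close>

definition braket :: "complex vec \<Rightarrow> complex mat \<Rightarrow> complex vec \<Rightarrow> complex" where
  "braket v E w = (E *\<^sub>v w) \<bullet>c v"

text \<open>Partial trace of an operator on \<open>\<complex>\<^sup>a \<otimes> \<complex>\<^sup>b\<close> over the first factor.\<close>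

definition ptrace_fst :: "nat \<Rightarrow> nat \<Rightarrow> complex mat \<Rightarrow> complex mat" where
  "ptrace_fst a b A = mat b b (\<lambda>(i, j). \<Sum>k<a. A $$ (k * b + i, k * b + j))"


section \<open>Pauli operators\<close>

definition sigma_x :: "complex mat" where
  "sigma_x = mat_of_rows_list 2 [[0, 1], [1, 0]]"

definition sigma_y :: "complex mat" where
  "sigma_y = mat_of_rows_list 2 [[0, - \<i>], [\<i>, 0]]"

definition sigma_z :: "complex mat" where
  "sigma_z = mat_of_rows_list 2 [[1, 0], [0, - 1]]"

definition paulis :: "complex mat set" where
  "paulis = {1\<^sub>m 2, sigma_x, sigma_y, sigma_z}"

definition tensor_list :: "complex mat list \<Rightarrow> complex mat" where
  "tensor_list ss = foldr (\<otimes>\<^sub>k) ss (1\<^sub>m 1)"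

definition pauli_ops :: "nat \<Rightarrow> complex mat set" where
  "pauli_ops m = {tensor_list ss | ss. length ss = m \<and> set ss \<subseteq> paulis}"

text \<open>The tensor factors of a Pauli operator are uniquely determined, see
  \<open>tensor_list_inj\<close> and \<open>wt_tensor_list\<close> below.\<close>

definition wt :: "complex mat \<Rightarrow> nat" where
  "wt E = (THE k. \<exists>ss. set ss \<subseteq> paulis \<and> E = tensor_list ss
     \<and> k = length (filter (\<lambda>s. s \<noteq> 1\<^sub>m 2) ss))"

lemma pauli_entries:
  "1\<^sub>m 2 $$ (0,0) = (1::complex)" "1\<^sub>m 2 $$ (0,1) = (0::complex)"
  "1\<^sub>m 2 $$ (1,0) = (0::complex)" "1\<^sub>m 2 $$ (1,1) = (1::complex)"
  "sigma_x $$ (0,0) = 0" "sigma_x $$ (0,1) = 1" "sigma_x $$ (1,0) = 1" "sigma_x $$ (1,1) = 0"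
  "sigma_y $$ (0,0) = 0" "sigma_y $$ (0,1) = - \<i>" "sigma_y $$ (1,0) = \<i>" "sigma_y $$ (1,1) = 0"
  "sigma_z $$ (0,0) = 1" "sigma_z $$ (0,1) = 0" "sigma_z $$ (1,0) = 0" "sigma_z $$ (1,1) = - 1"
  by (auto simp: sigma_x_def sigma_y_def sigma_z_def mat_of_rows_list_def)

lemma paulis_carrier: "s \<in> paulis \<Longrightarrow> s \<in> carrier_mat 2 2"
  by (auto simp: paulis_def sigma_x_def sigma_y_def sigma_z_def mat_of_rows_list_def)

lemma paulis_nonzero:
  assumes "s \<in> paulis"
  obtains a b where "a < 2" "b < 2" "s $$ (a, b) \<noteq> 0"
proof -
  have "s $$ (0,0) \<noteq> 0 \<or> s $$ (0,1) \<noteq> 0"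
    using assms by (auto simp: paulis_def pauli_entries simp del: One_nat_def)
  then show ?thesis using that[of 0 0] that[of 0 1] by auto
qed

lemma paulis_proportional:
  assumes s: "s \<in> paulis" and t: "t \<in> paulis" and x: "x \<noteq> (0::complex)"
    and eq: "\<And>a b. a < 2 \<Longrightarrow> b < 2 \<Longrightarrow> s $$ (a, b) * x = t $$ (a, b) * y"
  shows "s = t"
proof -
  have "s $$ (0,0) * x = t $$ (0,0) * y" "s $$ (0,1) * x = t $$ (0,1) * y"
    "s $$ (1,0) * x = t $$ (1,0) * y" "s $$ (1,1) * x = t $$ (1,1) * y"
    using eq[of 0 0] eq[of 0 1] eq[of 1 0] eq[of 1 1] by auto
  then show ?thesis using s t x
    unfolding paulis_def by (auto simp: pauli_entries simp del: One_nat_def)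
qed

lemma tensor_list_Nil [simp]: "tensor_list [] = 1\<^sub>m 1"
  by (simp add: tensor_list_def)

lemma tensor_list_Cons [simp]: "tensor_list (s # ss) = s \<otimes>\<^sub>k tensor_list ss"
  by (simp add: tensor_list_def)

lemma kron_carrier:
  "A \<in> carrier_mat r c \<Longrightarrow> B \<in> carrier_mat r' c' \<Longrightarrow> A \<otimes>\<^sub>k B \<in> carrier_mat (r * r') (c * c')"
  by (auto simp: kron_def)

lemma kron_index:
  assumes A: "A \<in> carrier_mat r c" and B: "B \<in> carrier_mat r' c'"
    and "a < r" "b < c" and i: "i < r'" and j: "j < c'"
  shows "(A \<otimes>\<^sub>k B) $$ (a * r' + i, b * c' + j) = A $$ (a, b) * B $$ (i, j)"
proof -
  have "a * r' + i < Suc a * r'" "b * c' + j < Suc b * c'" using i j by auto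
  moreover have "Suc a * r' \<le> r * r'" "Suc b * c' \<le> c * c'"
    using assms by (auto intro!: mult_le_mono1 simp del: mult_Suc)
  ultimately have "a * r' + i < r * r'" "b * c' + j < c * c'" by linarith+
  then show ?thesis using A B i j by (auto simp: kron_def)
qed

lemma tensor_list_carrier:
  "set ss \<subseteq> paulis \<Longrightarrow> tensor_list ss \<in> carrier_mat (2 ^ length ss) (2 ^ length ss)"
  by (induction ss) (auto intro!: kron_carrier paulis_carrier)

lemma tensor_list_nonzero:
  "set ss \<subseteq> paulis \<Longrightarrow>
    \<exists>i < 2 ^ length ss. \<exists>j < 2 ^ length ss. tensor_list ss $$ (i, j) \<noteq> 0"
proof (induction ss)
  case (Cons s ss)
  let ?N = "2 ^ length ss :: nat"
  from Cons obtain i j where ij: "i < ?N" "j < ?N" "tensor_list ss $$ (i, j) \<noteq> 0" by auto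
  from Cons obtain a b where ab: "a < 2" "b < 2" "s $$ (a, b) \<noteq> 0"
    by (meson list.set_intros(1) paulis_nonzero subsetD)
  have s: "s \<in> carrier_mat 2 2" and T: "tensor_list ss \<in> carrier_mat ?N ?N"
    using Cons.prems by (auto intro: paulis_carrier tensor_list_carrier)
  have "tensor_list (s # ss) $$ (a * ?N + i, b * ?N + j) \<noteq> 0"
    using kron_index[OF s T ab(1,2) ij(1,2)] ab ij by simp
  moreover have "a * ?N + i < 2 ^ length (s # ss)" "b * ?N + j < 2 ^ length (s # ss)"
    using ab ij by (auto simp: less_2_cases_iff)
  ultimately show ?case by blast
qed simp

lemma tensor_list_inj:
  assumes "set ss \<subseteq> paulis" "set ts \<subseteq> paulis" "tensor_list ss = tensor_list ts"
  shows "ss = ts"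
proof -
  have "(2::nat) ^ length ss = 2 ^ length ts"
    using assms tensor_list_carrier by (metis carrier_matD(1))
  then have "length ss = length ts" by simp
  then show ?thesis using assms
  proof (induction ss ts rule: list_induct2)
    case (Cons s ss t ts)
    let ?N = "2 ^ length ss :: nat"
    have st: "s \<in> paulis" "t \<in> paulis" and c: "s \<in> carrier_mat 2 2" "t \<in> carrier_mat 2 2"
      and S: "tensor_list ss \<in> carrier_mat ?N ?N" and T: "tensor_list ts \<in> carrier_mat ?N ?N"
      using Cons.prems Cons.hyps tensor_list_carrier[of ss] tensor_list_carrier[of ts]
      by (auto intro: paulis_carrier)
    have eq: "s $$ (a, b) * tensor_list ss $$ (i, j) = t $$ (a, b) * tensor_list ts $$ (i, j)"
      if "a < 2" "b < 2" "i < ?N" "j < ?N" for a b i j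
      using kron_index[OF c(1) S that] kron_index[OF c(2) T that] Cons.prems by simp
    obtain i j where ij: "i < ?N" "j < ?N" "tensor_list ss $$ (i, j) \<noteq> 0"
      using tensor_list_nonzero[of ss] Cons.prems by auto
    have "s = t"
      by (rule paulis_proportional[OF st ij(3)]) (use eq ij in auto)
    moreover have "tensor_list ss = tensor_list ts"
    proof -
      obtain a b where "a < 2" "b < 2" "s $$ (a, b) \<noteq> 0" using paulis_nonzero st by blast
      then show ?thesis using eq S T \<open>s = t\<close> by (intro eq_matI) auto
    qed
    ultimately show ?case using Cons by auto
  qed simp
qed

lemma wt_tensor_list:
  "set ss \<subseteq> paulis \<Longrightarrow> wt (tensor_list ss) = length (filter (\<lambda>s. s \<noteq> 1\<^sub>m 2) ss)"
  unfolding wt_def by (rule the_equality) (use tensor_list_inj in blast)+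

lemma finite_pauli_ops: "finite (pauli_ops m)"
proof -
  have "finite {ss. set ss \<subseteq> paulis \<and> length ss = m}"
    by (rule finite_lists_length_eq) (simp add: paulis_def)
  moreover have "pauli_ops m = tensor_list ` {ss. set ss \<subseteq> paulis \<and> length ss = m}"
    by (auto simp: pauli_ops_def)
  ultimately show ?thesis by simp
qed


section \<open>Subspaces, projectors and detectability\<close>

abbreviation cspace :: "nat \<Rightarrow> (complex, complex vec) module" where
  "cspace N \<equiv> module_vec TYPE(complex) N"

definition orthonormal_basis :: "nat \<Rightarrow> complex vec set \<Rightarrow> complex vec set \<Rightarrow> bool" where
  "orthonormal_basis N Q B \<longleftrightarrow>
     vectorspace.basis class_ring ((cspace N)\<lparr>carrier := Q\<rparr>) B \<and>
     (\<forall>v\<in>B. \<forall>w\<in>B. v \<bullet>c w = (if v = w then 1 else 0))"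

definition detectable :: "nat \<Rightarrow> complex vec set \<Rightarrow> complex mat \<Rightarrow> bool" where
  "detectable N Q E \<longleftrightarrow> (\<exists>B. orthonormal_basis N Q B \<and>
     (\<forall>v\<in>B. \<forall>w\<in>B. braket v E v = braket w E w) \<and>
     (\<forall>v\<in>B. \<forall>w\<in>B. v \<noteq> w \<longrightarrow> braket v E w = 0))"

definition is_orth_projector :: "nat \<Rightarrow> complex vec set \<Rightarrow> complex mat \<Rightarrow> bool" where
  "is_orth_projector N Q P \<longleftrightarrow> P \<in> carrier_mat N N \<and> P * P = P \<and> mat_adjoint P = P \<and>
     (\<lambda>v. P *\<^sub>v v) ` carrier_vec N = Q"

definition orth_projector :: "nat \<Rightarrow> complex vec set \<Rightarrow> complex mat" where
  "orth_projector N Q = (THE P. is_orth_projector N Q P)"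


section \<open>Entanglement-assisted codes and generalized stabilizer sets\<close>

definition ea_code :: "nat \<Rightarrow> nat \<Rightarrow> nat \<Rightarrow> nat \<Rightarrow> complex vec set \<Rightarrow> bool" where
  "ea_code n M d c Q \<longleftrightarrow>
     VectorSpace.subspace class_ring Q (cspace (2 ^ (n + c))) \<and>
     vectorspace.dim class_ring ((cspace (2 ^ (n + c)))\<lparr>carrier := Q\<rparr>) = M \<and>
     (\<forall>v\<in>Q. v \<bullet>c v = 1 \<longrightarrow>
        ptrace_fst (2 ^ n) (2 ^ c) (ketbra v v) = (1 / 2 ^ c) \<cdot>\<^sub>m 1\<^sub>m (2 ^ c)) \<and>
     (\<forall>\<alpha>\<in>pauli_ops n. int (wt \<alpha>) \<le> int d - 1 \<longrightarrow>
        detectable (2 ^ (n + c)) Q (\<alpha> \<otimes>\<^sub>k 1\<^sub>m (2 ^ c))) \<and>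
     \<not> (\<forall>\<alpha>\<in>pauli_ops n. wt \<alpha> = d \<longrightarrow>
        detectable (2 ^ (n + c)) Q (\<alpha> \<otimes>\<^sub>k 1\<^sub>m (2 ^ c)))"

definition gs_set :: "nat \<Rightarrow> nat \<Rightarrow> complex vec set \<Rightarrow> real \<Rightarrow> complex mat set" where
  "gs_set n c Q j = (let P = orth_projector (2 ^ (n + c)) Q in
     {\<beta> \<in> pauli_ops n. P * (\<beta> \<otimes>\<^sub>k 1\<^sub>m (2 ^ c)) * P = complex_of_real j \<cdot>\<^sub>m P})"

end

theory Submission
  imports Defs
begin

text \<open>Polarising from an orthonormal basis to the whole of \<open>Q\<close> shows that \<open>E\<close> is detectable
  iff the compression \<open>P E P\<close> to \<open>Q\<close> is a scalar multiple of \<open>P\<close>. When \<open>E\<close> is a Hermitian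
  involution, as \<open>\<alpha> \<otimes> I\<close> is for a Pauli operator \<open>\<alpha>\<close>, this scalar is automatically real and lies in
  \<open>[-1, 1]\<close>. So the undetectable \<open>\<alpha>\<close> are exactly those outside all generalized stabilizer sets.\<close>

subsection \<open>Adjoints and Kronecker products\<close>

lemma mat_adjoint_carrier: "A \<in> carrier_mat r c \<Longrightarrow> mat_adjoint A \<in> carrier_mat c r"
  by (auto simp: mat_adjoint_def)

lemma mat_adjoint_index:
  fixes A :: "complex mat"
  assumes "A \<in> carrier_mat r c" "i < c" "j < r"
  shows "mat_adjoint A $$ (i, j) = cnj (A $$ (j, i))"
  using assms by (auto simp: mat_adjoint_def mat_of_rows_index)

lemma mat_adjoint_mult:
  fixes A B :: "complex mat"
  assumes A: "A \<in> carrier_mat r k" and B: "B \<in> carrier_mat k c"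
  shows "mat_adjoint (A * B) = mat_adjoint B * mat_adjoint A"
proof (rule eq_matI)
  have A': "mat_adjoint A \<in> carrier_mat k r" and B': "mat_adjoint B \<in> carrier_mat c k"
    and AB: "A * B \<in> carrier_mat r c" and AB': "mat_adjoint (A * B) \<in> carrier_mat c r"
    using A B by (auto intro!: mat_adjoint_carrier)
  show "dim_row (mat_adjoint (A * B)) = dim_row (mat_adjoint B * mat_adjoint A)"
    "dim_col (mat_adjoint (A * B)) = dim_col (mat_adjoint B * mat_adjoint A)"
    using A' B' AB' by auto
  fix i j assume "i < dim_row (mat_adjoint B * mat_adjoint A)" "j < dim_col (mat_adjoint B * mat_adjoint A)"
  then have ij: "i < c" "j < r" using A' B' by auto
  have "mat_adjoint (A * B) $$ (i, j) = cnj (\<Sum>l<k. A $$ (j, l) * B $$ (l, i))"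
    using mat_adjoint_index[OF AB ij] A B ij by (simp add: scalar_prod_def atLeast0LessThan)
  also have "\<dots> = (\<Sum>l<k. mat_adjoint B $$ (i, l) * mat_adjoint A $$ (l, j))"
    using ij by (simp add: mat_adjoint_index[OF A] mat_adjoint_index[OF B] mult.commute)
  also have "\<dots> = (mat_adjoint B * mat_adjoint A) $$ (i, j)"
    using A' B' ij by (simp add: scalar_prod_def atLeast0LessThan)
  finally show "mat_adjoint (A * B) $$ (i, j) = (mat_adjoint B * mat_adjoint A) $$ (i, j)" .
qed

lemma mat_adjoint_one: "mat_adjoint (1\<^sub>m n :: complex mat) = 1\<^sub>m n"
proof (rule eq_matI)
  have "mat_adjoint (1\<^sub>m n :: complex mat) \<in> carrier_mat n n"
    by (intro mat_adjoint_carrier one_carrier_mat)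
  then show "dim_row (mat_adjoint (1\<^sub>m n :: complex mat)) = dim_row (1\<^sub>m n :: complex mat)"
    "dim_col (mat_adjoint (1\<^sub>m n :: complex mat)) = dim_col (1\<^sub>m n :: complex mat)" by auto
  show "mat_adjoint (1\<^sub>m n :: complex mat) $$ (i, j) = 1\<^sub>m n $$ (i, j)"
    if "i < dim_row (1\<^sub>m n :: complex mat)" "j < dim_col (1\<^sub>m n :: complex mat)" for i j
    using that mat_adjoint_index[OF one_carrier_mat, of i n j] by auto
qed

lemma less_mult_divmod:
  fixes i m b :: nat
  assumes "i < m * b"
  shows "i div b < m" "i mod b < b"
proof -
  have "b > 0" using assms by (cases b) auto
  then show "i div b < m" "i mod b < b" using assms by (auto simp: less_mult_imp_div_less)
qed

text \<open>The Kronecker ordering makes the summation index run through blocks of length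
  \<open>k'\<close>. Writing it as \<open>p * k' + q\<close> separates the summand into a factor in
  \<open>p\<close> and a factor in \<open>q\<close>, so the double sum is a product of two
  sums.\<close>

lemma kron_mult:
  assumes A: "A \<in> carrier_mat r k" and B: "B \<in> carrier_mat r' k'"
    and C: "C \<in> carrier_mat k c" and D: "D \<in> carrier_mat k' c'"
  shows "(A \<otimes>\<^sub>k B) * (C \<otimes>\<^sub>k D) = (A * C) \<otimes>\<^sub>k (B * D)"
proof (rule eq_matI)
  have AB: "A \<otimes>\<^sub>k B \<in> carrier_mat (r * r') (k * k')" and CD: "C \<otimes>\<^sub>k D \<in> carrier_mat (k * k') (c * c')"
    and R: "(A * C) \<otimes>\<^sub>k (B * D) \<in> carrier_mat (r * r') (c * c')"
    using assms by (auto intro!: kron_carrier mult_carrier_mat)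
  show "dim_row ((A \<otimes>\<^sub>k B) * (C \<otimes>\<^sub>k D)) = dim_row ((A * C) \<otimes>\<^sub>k (B * D))"
    "dim_col ((A \<otimes>\<^sub>k B) * (C \<otimes>\<^sub>k D)) = dim_col ((A * C) \<otimes>\<^sub>k (B * D))"
    using AB CD R by auto
  fix i j assume "i < dim_row ((A * C) \<otimes>\<^sub>k (B * D))" "j < dim_col ((A * C) \<otimes>\<^sub>k (B * D))"
  then have ij: "i < r * r'" "j < c * c'" using R by auto
  define a x b y where "a = i div r'" and "x = i mod r'" and "b = j div c'" and "y = j mod c'"
  have ax: "a < r" "x < r'" "i = a * r' + x" and cy: "b < c" "y < c'" "j = b * c' + y"
    using ij by (auto simp: less_mult_divmod a_def x_def b_def y_def)
  have "((A \<otimes>\<^sub>k B) * (C \<otimes>\<^sub>k D)) $$ (i, j) = (\<Sum>l<k * k'. (A \<otimes>\<^sub>k B) $$ (i, l) * (C \<otimes>\<^sub>k D) $$ (l, j))"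
    using AB CD ij by (simp add: scalar_prod_def atLeast0LessThan)
  also have "\<dots> = (\<Sum>p<k. \<Sum>l\<in>{p * k'..<p * k' + k'}. (A \<otimes>\<^sub>k B) $$ (i, l) * (C \<otimes>\<^sub>k D) $$ (l, j))"
    by (rule sum.nat_group[symmetric])
  also have "\<dots> = (\<Sum>p<k. \<Sum>q<k'. (A \<otimes>\<^sub>k B) $$ (i, p * k' + q) * (C \<otimes>\<^sub>k D) $$ (p * k' + q, j))"
  proof (rule sum.cong[OF refl])
    fix p
    show "(\<Sum>l\<in>{p * k'..<p * k' + k'}. (A \<otimes>\<^sub>k B) $$ (i, l) * (C \<otimes>\<^sub>k D) $$ (l, j))
        = (\<Sum>q<k'. (A \<otimes>\<^sub>k B) $$ (i, p * k' + q) * (C \<otimes>\<^sub>k D) $$ (p * k' + q, j))"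
      by (rule sum.reindex_bij_witness[of _ "\<lambda>q. p * k' + q" "\<lambda>l. l - p * k'"]) auto
  qed
  also have "\<dots> = (\<Sum>p<k. \<Sum>q<k'. (A $$ (a, p) * C $$ (p, b)) * (B $$ (x, q) * D $$ (q, y)))"
    using ax cy by (intro sum.cong refl) (simp add: kron_index[OF A B] kron_index[OF C D])
  also have "\<dots> = (A * C) $$ (a, b) * (B * D) $$ (x, y)"
    using assms ax cy by (simp add: scalar_prod_def atLeast0LessThan sum_product)
  also have "\<dots> = ((A * C) \<otimes>\<^sub>k (B * D)) $$ (i, j)"
    using kron_index[OF mult_carrier_mat[OF A C] mult_carrier_mat[OF B D] ax(1) cy(1) ax(2) cy(2)] ax(3) cy(3)
    by simp
  finally show "((A \<otimes>\<^sub>k B) * (C \<otimes>\<^sub>k D)) $$ (i, j) = ((A * C) \<otimes>\<^sub>k (B * D)) $$ (i, j)" .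
qed

lemma kron_adjoint:
  assumes A: "A \<in> carrier_mat r c" and B: "B \<in> carrier_mat r' c'"
  shows "mat_adjoint (A \<otimes>\<^sub>k B) = mat_adjoint A \<otimes>\<^sub>k mat_adjoint B"
proof (rule eq_matI)
  have AB: "A \<otimes>\<^sub>k B \<in> carrier_mat (r * r') (c * c')" by (rule kron_carrier[OF A B])
  have A': "mat_adjoint A \<in> carrier_mat c r" and B': "mat_adjoint B \<in> carrier_mat c' r'"
    using A B by (auto intro: mat_adjoint_carrier)
  have R: "mat_adjoint A \<otimes>\<^sub>k mat_adjoint B \<in> carrier_mat (c * c') (r * r')" by (rule kron_carrier[OF A' B'])
  show "dim_row (mat_adjoint (A \<otimes>\<^sub>k B)) = dim_row (mat_adjoint A \<otimes>\<^sub>k mat_adjoint B)"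
    "dim_col (mat_adjoint (A \<otimes>\<^sub>k B)) = dim_col (mat_adjoint A \<otimes>\<^sub>k mat_adjoint B)"
    using mat_adjoint_carrier[OF AB] R by auto
  fix i j assume "i < dim_row (mat_adjoint A \<otimes>\<^sub>k mat_adjoint B)" "j < dim_col (mat_adjoint A \<otimes>\<^sub>k mat_adjoint B)"
  then have ij: "i < c * c'" "j < r * r'" using R by auto
  have "mat_adjoint (A \<otimes>\<^sub>k B) $$ (i, j) = cnj ((A \<otimes>\<^sub>k B) $$ (j, i))"
    by (rule mat_adjoint_index[OF AB ij])
  also have "\<dots> = (mat_adjoint A \<otimes>\<^sub>k mat_adjoint B) $$ (i, j)"
    using A B A' B' ij by (simp add: less_mult_divmod kron_def mat_adjoint_index[OF A] mat_adjoint_index[OF B])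
  finally show "mat_adjoint (A \<otimes>\<^sub>k B) $$ (i, j) = (mat_adjoint A \<otimes>\<^sub>k mat_adjoint B) $$ (i, j)" .
qed

lemma kron_one: "1\<^sub>m a \<otimes>\<^sub>k 1\<^sub>m b = 1\<^sub>m (a * b)"
proof (rule eq_matI)
  fix i j assume "i < dim_row (1\<^sub>m (a * b) :: complex mat)" "j < dim_col (1\<^sub>m (a * b) :: complex mat)"
  moreover have "i = j \<longleftrightarrow> i div b = j div b \<and> i mod b = j mod b"
    by (metis div_mult_mod_eq)
  ultimately show "(1\<^sub>m a \<otimes>\<^sub>k 1\<^sub>m b) $$ (i, j) = 1\<^sub>m (a * b) $$ (i, j)"
    by (auto simp: kron_def less_mult_divmod)
qed (auto simp: kron_def)

section \<open>Pauli operators as Hermitian involutions\<close>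

lemma eq_mat2I:
  assumes "A \<in> carrier_mat 2 2" "B \<in> carrier_mat 2 2"
    "A $$ (0, 0) = B $$ (0, 0)" "A $$ (0, 1) = B $$ (0, 1)"
    "A $$ (1, 0) = B $$ (1, 0)" "A $$ (1, 1) = B $$ (1, 1)"
  shows "A = B"
  using assms by (intro eq_matI) (auto simp: less_2_cases_iff)

lemma paulis_hermitian:
  assumes "s \<in> paulis"
  shows "mat_adjoint s = s"
proof (rule eq_mat2I)
  have s: "s \<in> carrier_mat 2 2" using assms by (rule paulis_carrier)
  show "mat_adjoint s \<in> carrier_mat 2 2" "s \<in> carrier_mat 2 2"
    using s by (auto intro: mat_adjoint_carrier)
  show "mat_adjoint s $$ (0, 0) = s $$ (0, 0)" "mat_adjoint s $$ (0, 1) = s $$ (0, 1)"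
    "mat_adjoint s $$ (1, 0) = s $$ (1, 0)" "mat_adjoint s $$ (1, 1) = s $$ (1, 1)"
    using assms by (auto simp: mat_adjoint_index[OF s] paulis_def pauli_entries simp del: One_nat_def index_one_mat)
qed

lemma paulis_involution:
  assumes "s \<in> paulis"
  shows "s * s = 1\<^sub>m 2"
proof (rule eq_mat2I)
  have s: "s \<in> carrier_mat 2 2" using assms by (rule paulis_carrier)
  show "s * s \<in> carrier_mat 2 2" "(1\<^sub>m 2 :: complex mat) \<in> carrier_mat 2 2"
    using s by auto
  have "(s * s) $$ (i, j) = s $$ (i, 0) * s $$ (0, j) + s $$ (i, 1) * s $$ (1, j)" if "i < 2" "j < 2" for i j
    using that s by (simp add: scalar_prod_def numeral_2_eq_2)
  note * = this
  show "(s * s) $$ (0, 0) = 1\<^sub>m 2 $$ (0, 0)" "(s * s) $$ (0, 1) = 1\<^sub>m 2 $$ (0, 1)"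
    "(s * s) $$ (1, 0) = 1\<^sub>m 2 $$ (1, 0)" "(s * s) $$ (1, 1) = 1\<^sub>m 2 $$ (1, 1)"
    using assms by (auto simp: * paulis_def pauli_entries simp del: One_nat_def index_one_mat)
qed

text \<open>Adjoints and products act factorwise on Kronecker products, so both properties are
  inherited from the 2 by 2 Pauli matrices.\<close>

lemma tensor_list_hermitian_involution:
  "set ss \<subseteq> paulis \<Longrightarrow> mat_adjoint (tensor_list ss) = tensor_list ss \<and>
    tensor_list ss * tensor_list ss = 1\<^sub>m (2 ^ length ss)"
proof (induction ss)
  case Nil
  then show ?case by (simp add: mat_adjoint_one)
next
  case (Cons s ss)
  then have s: "s \<in> paulis" and T: "tensor_list ss \<in> carrier_mat (2 ^ length ss) (2 ^ length ss)"
    by (auto intro: tensor_list_carrier)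
  note s' = paulis_carrier[OF s]
  show ?case
    using Cons s by (simp add: kron_adjoint[OF s' T] kron_mult[OF s' T s' T] paulis_hermitian
        paulis_involution kron_one)
qed

text \<open>These three facts are all that the analysis of compressions below asks of the error
  operator.\<close>

lemma pauli_ops_kron_one:
  fixes c :: nat
  assumes "\<alpha> \<in> pauli_ops n"
  defines "E \<equiv> \<alpha> \<otimes>\<^sub>k 1\<^sub>m (2 ^ c)"
  shows "E \<in> carrier_mat (2 ^ (n + c)) (2 ^ (n + c))" "mat_adjoint E = E" "E * E = 1\<^sub>m (2 ^ (n + c))"
proof -
  have \<alpha>: "\<alpha> \<in> carrier_mat (2 ^ n) (2 ^ n)" "mat_adjoint \<alpha> = \<alpha>" "\<alpha> * \<alpha> = 1\<^sub>m (2 ^ n)"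
    using assms tensor_list_hermitian_involution tensor_list_carrier by (auto simp: pauli_ops_def)
  have I: "(1\<^sub>m (2 ^ c) :: complex mat) \<in> carrier_mat (2 ^ c) (2 ^ c)" by simp
  show "E \<in> carrier_mat (2 ^ (n + c)) (2 ^ (n + c))"
    using kron_carrier[OF \<alpha>(1) I] by (simp add: E_def power_add)
  show "mat_adjoint E = E"
    by (simp add: E_def kron_adjoint[OF \<alpha>(1) I] \<alpha>(2) mat_adjoint_one)
  show "E * E = 1\<^sub>m (2 ^ (n + c))"
    by (simp add: E_def kron_mult[OF \<alpha>(1) I \<alpha>(1) I] \<alpha>(3) kron_one power_add)
qed

subsection \<open>Inner products\<close>

lemma cnj_cscalar_prod:
  fixes v w :: "complex vec"
  assumes "v \<in> carrier_vec n" "w \<in> carrier_vec n"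
  shows "cnj (v \<bullet>c w) = w \<bullet>c v"
  using assms by (simp add: scalar_prod_def mult.commute)

lemma cscalar_prod_adjoint:
  fixes A :: "complex mat"
  assumes A: "A \<in> carrier_mat r c" and v: "v \<in> carrier_vec c" and w: "w \<in> carrier_vec r"
  shows "(A *\<^sub>v v) \<bullet>c w = v \<bullet>c (mat_adjoint A *\<^sub>v w)"
proof -
  have "(A *\<^sub>v v) \<bullet>c w = (\<Sum>i<r. \<Sum>j<c. A $$ (i, j) * v $ j * cnj (w $ i))"
    using assms by (simp add: scalar_prod_def atLeast0LessThan sum_distrib_right)
  also have "\<dots> = (\<Sum>j<c. \<Sum>i<r. A $$ (i, j) * v $ j * cnj (w $ i))"
    by (rule sum.swap)
  also have "\<dots> = v \<bullet>c (mat_adjoint A *\<^sub>v w)"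
    using assms mat_adjoint_carrier[OF A]
    by (simp add: scalar_prod_def atLeast0LessThan sum_distrib_left mat_adjoint_index[OF A] mult_ac)
  finally show ?thesis .
qed

lemma eq_mat_mult_vecI:
  fixes A B :: "complex mat"
  assumes A: "A \<in> carrier_mat r c" and B: "B \<in> carrier_mat r c"
    and eq: "\<And>v. v \<in> carrier_vec c \<Longrightarrow> A *\<^sub>v v = B *\<^sub>v v"
  shows "A = B"
proof (rule eq_matI)
  fix i j assume ij: "i < dim_row B" "j < dim_col B"
  have "(A *\<^sub>v unit_vec c j) $ i = (B *\<^sub>v unit_vec c j) $ i" using eq by simp
  then show "A $$ (i, j) = B $$ (i, j)" using A B ij by simp
qed (use A B in auto)

lemma smult_mat_mult_vec:
  fixes A :: "complex mat"
  assumes "A \<in> carrier_mat r c" "v \<in> carrier_vec c"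
  shows "(a \<cdot>\<^sub>m A) *\<^sub>v v = a \<cdot>\<^sub>v (A *\<^sub>v v)"
  using assms by (intro eq_vecI) auto

lemma eq_vec_cscalar_prodI:
  fixes v w :: "complex vec"
  assumes v: "v \<in> carrier_vec n" and w: "w \<in> carrier_vec n"
    and eq: "\<And>x. x \<in> carrier_vec n \<Longrightarrow> v \<bullet>c x = w \<bullet>c x"
  shows "v = w"
proof (rule eq_vecI)
  fix i assume "i < dim_vec w"
  then show "v $ i = w $ i"
    using eq[of "unit_vec n i"] v w by (simp add: scalar_prod_def unit_vec_def if_distrib cong: if_cong)
qed (use v w in auto)


subsection \<open>Orthonormal bases and orthogonal projectors\<close>

lemma submodule_cspaceI:
  assumes "S \<subseteq> carrier_vec N" "0\<^sub>v N \<in> S"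
    "\<And>v w. v \<in> S \<Longrightarrow> w \<in> S \<Longrightarrow> v + w \<in> S" "\<And>a v. v \<in> S \<Longrightarrow> a \<cdot>\<^sub>v v \<in> S"
  shows "submodule class_ring S (cspace N)"
  using assms vec_module by (intro submodule.intro) (auto simp: module_vec_simps)

lemma subspace_cspaceD:
  assumes "VectorSpace.subspace class_ring S (cspace N)"
  shows "S \<subseteq> carrier_vec N" "0\<^sub>v N \<in> S"
    "\<And>v w. v \<in> S \<Longrightarrow> w \<in> S \<Longrightarrow> v + w \<in> S" "\<And>a v. v \<in> S \<Longrightarrow> a \<cdot>\<^sub>v v \<in> S"
proof -
  interpret submodule class_ring S "cspace N"
    using assms by (simp add: VectorSpace.subspace_def)
  show "S \<subseteq> carrier_vec N" "0\<^sub>v N \<in> S"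
    "\<And>v w. v \<in> S \<Longrightarrow> w \<in> S \<Longrightarrow> v + w \<in> S" "\<And>a v. v \<in> S \<Longrightarrow> a \<cdot>\<^sub>v v \<in> S"
    using subset zero_closed m_closed smult_closed by (auto simp: module_vec_simps)
qed

text \<open>The metric half of \<open>orthonormal_basis\<close>, kept apart from the spanning half
  so that it can be used for sets not yet known to span.\<close>

definition orthonormal :: "complex vec set \<Rightarrow> bool" where
  "orthonormal B \<longleftrightarrow> (\<forall>v\<in>B. \<forall>w\<in>B. v \<bullet>c w = (if v = w then 1 else 0))"

context
  fixes N :: nat
begin

interpretation V: vec_space "TYPE(complex)" N .

lemma lincomb_cscalar_prod:
  assumes "A \<subseteq> carrier_vec N" "w \<in> carrier_vec N"
  shows "V.lincomb a A \<bullet>c w = (\<Sum>v\<in>A. a v * (v \<bullet>c w))"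
proof -
  have "V.lincomb a A \<bullet>c w = (\<Sum>v\<in>A. (a v \<cdot>\<^sub>v v) \<bullet>c w)"
    unfolding V.lincomb_def using assms
    by (subst V.finsum_scalar_prod_sum) (auto simp: module_vec_simps)
  also have "\<dots> = (\<Sum>v\<in>A. a v * (v \<bullet>c w))"
    using assms by (intro sum.cong refl smult_scalar_prod_distrib[of _ N]) auto
  finally show ?thesis .
qed

text \<open>Pairing with \<open>w\<close> kills every other term. This gives linear independence,
  and it also makes the residual of an orthogonal expansion orthogonal to the set expanded
  in.\<close>

lemma orthonormal_coefficient:
  assumes B: "orthonormal B" "B \<subseteq> carrier_vec N" and A: "finite A" "A \<subseteq> B" "w \<in> A"
  shows "V.lincomb a A \<bullet>c w = a w"
proof -
  have "V.lincomb a A \<bullet>c w = (\<Sum>v\<in>A. a v * (v \<bullet>c w))"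
    using assms by (intro lincomb_cscalar_prod) auto
  also have "\<dots> = (\<Sum>v\<in>A. if v = w then a v else 0)"
  proof (rule sum.cong[OF refl])
    fix v assume "v \<in> A"
    then have "v \<in> B" "w \<in> B" using A by auto
    then have "v \<bullet>c w = (if v = w then 1 else 0)"
      using B(1) unfolding orthonormal_def by blast
    then show "a v * (v \<bullet>c w) = (if v = w then a v else 0)" by simp
  qed
  also have "\<dots> = a w" using A by simp
  finally show ?thesis .
qed

lemma orthonormal_lin_indpt:
  assumes B: "orthonormal B" "B \<subseteq> carrier_vec N"
  shows "V.lin_indpt B"
proof
  assume "V.lin_dep B"
  then obtain A a v where A: "finite A" "A \<subseteq> B" "V.lincomb a A = 0\<^sub>v N" "v \<in> A" "a v \<noteq> 0"
    unfolding V.lin_dep_def by (auto simp: module_vec_simps)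
  have "a v = 0\<^sub>v N \<bullet>c v"
    using orthonormal_coefficient[OF B A(1,2,4), of a] A(3) by simp
  also have "\<dots> = 0" using A B by (intro scalar_prod_left_zero) auto
  finally show False using A by simp
qed

text \<open>Independence bounds the cardinality by the dimension; this bound is what makes an
  orthonormal set of maximal cardinality available.\<close>

lemma orthonormal_card:
  assumes B: "orthonormal B" "B \<subseteq> carrier_vec N"
  shows "finite B" "card B \<le> N"
  using V.li_le_dim[OF V.fin_dim _ orthonormal_lin_indpt[OF B]] B(2) by (auto simp: V.dim_is_n)

text \<open>A basis is defined inside the structure with carrier \<open>Q\<close>. Span and
  independence agree there with those of the ambient space, and independence is automatic for
  orthonormal sets, so only the span condition survives.\<close>

lemma orthonormal_basis_iff:
  assumes Q: "VectorSpace.subspace class_ring Q (cspace N)"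
  shows "orthonormal_basis N Q B \<longleftrightarrow> orthonormal B \<and> B \<subseteq> Q \<and> V.span B = Q"
proof -
  have sm: "submodule class_ring Q (cspace N)" using Q by (simp add: VectorSpace.subspace_def)
  interpret W: vectorspace class_ring "(cspace N)\<lparr>carrier := Q\<rparr>"
    using V.subspace_is_vs[OF Q] .
  have "B \<subseteq> Q \<Longrightarrow> orthonormal B \<Longrightarrow> V.lin_indpt B"
    using orthonormal_lin_indpt subspace_cspaceD(1)[OF Q] by blast
  then show ?thesis
    unfolding orthonormal_basis_def W.basis_def orthonormal_def[symmetric]
    using V.span_li_not_depend[OF _ sm, of B] by auto
qed

text \<open>An orthonormal subset of maximal cardinality spans: otherwise the normalised residual of an
  orthogonal expansion would extend it.\<close>

lemma orthonormal_basis_exists: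
  assumes Q: "VectorSpace.subspace class_ring Q (cspace N)"
  obtains B where "orthonormal_basis N Q B"
proof -
  note Qc = subspace_cspaceD[OF Q]
  have sm: "submodule class_ring Q (cspace N)" using Q by (simp add: VectorSpace.subspace_def)
  let ?P = "\<lambda>B. orthonormal B \<and> B \<subseteq> Q"
  have empty: "?P {}" by (simp add: orthonormal_def)
  have bound: "\<forall>B. ?P B \<longrightarrow> card B < Suc N"
    using orthonormal_card(2) Qc(1) by (meson le_imp_less_Suc subset_trans)
  from ex_has_greatest_nat[of ?P, OF empty bound]
  obtain B where B: "orthonormal B" "B \<subseteq> Q" and max: "\<And>C. ?P C \<Longrightarrow> card C \<le> card B" by auto
  have BN: "B \<subseteq> carrier_vec N" using B Qc by auto
  have fin: "finite B" using orthonormal_card B BN by blast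
  have span: "V.span B \<subseteq> Q" using V.span_is_subset[OF B(2) sm] .
  moreover have "x \<in> V.span B" if x: "x \<in> Q" for x
  proof (rule ccontr)
    assume ns: "x \<notin> V.span B"
    define y where "y = V.lincomb (\<lambda>b. x \<bullet>c b) B"
    define r where "r = x + (-1) \<cdot>\<^sub>v y"
    have yspan: "y \<in> V.span B" unfolding y_def V.span_def using fin by auto
    have yQ: "y \<in> Q" using span yspan by auto
    have rQ: "r \<in> Q" unfolding r_def using Qc yQ x by auto
    have cx: "x \<in> carrier_vec N" and cy: "y \<in> carrier_vec N" and cr: "r \<in> carrier_vec N"
      using x yQ rQ Qc by auto
    have "r \<noteq> 0\<^sub>v N"
    proof
      assume "r = 0\<^sub>v N"
      then have "x = y" using cx cy unfolding r_def
        by (auto simp: vec_eq_iff)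
      then show False using ns yspan by simp
    qed
    then have "r \<bullet>c r > 0" using conjugate_square_greater_0_vec[OF cr] by simp
    \<comment> \<open>Positivity in the order on complex numbers forces the imaginary part to
      vanish, so the squared norm is a positive real.\<close>
    then have s: "s > 0" "r \<bullet>c r = complex_of_real s" if "s = Re (r \<bullet>c r)" for s
      using that by (auto simp: less_complex_def complex_eq_iff)
    define s where "s = Re (r \<bullet>c r)"
    note s = s[OF s_def]
    \<comment> \<open>The residual has squared norm \<open>s\<close>, so this real factor normalises
      it.\<close>
    define k where "k = complex_of_real (1 / sqrt s)"
    define u where "u = k \<cdot>\<^sub>v r"
    have uQ: "u \<in> Q" unfolding u_def using Qc rQ by auto
    have cu: "u \<in> carrier_vec N" using uQ Qc by auto
    have rb: "r \<bullet>c b = 0" if b: "b \<in> B" for b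
    proof -
      have cb: "b \<in> carrier_vec N" using b BN by auto
      have "r \<bullet>c b = x \<bullet>c b + (-1) * (y \<bullet>c b)"
        unfolding r_def using cx cy cb
        by (subst add_scalar_prod_distrib[of _ N]) auto
      also have "y \<bullet>c b = x \<bullet>c b"
        unfolding y_def by (rule orthonormal_coefficient[OF B(1) BN fin _ b]) simp
      finally show ?thesis by simp
    qed
    have ub: "u \<bullet>c b = 0" if "b \<in> B" for b
      using rb[OF that] cr BN that unfolding u_def
      by (subst smult_scalar_prod_distrib[of _ N]) auto
    have bu: "b \<bullet>c u = 0" if "b \<in> B" for b
      using ub[OF that] cnj_cscalar_prod[of u N b] cu BN that by auto
    have "u \<bullet>c u = k * cnj k * (r \<bullet>c r)"
      unfolding u_def using cr by (simp add: conjugate_smult_vec)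
    also have "\<dots> = complex_of_real (1 / sqrt s * (1 / sqrt s) * s)"
      by (simp only: k_def s complex_cnj_complex_of_real of_real_mult)
    also have "1 / sqrt s * (1 / sqrt s) * s = 1" using s by simp
    finally have uu: "u \<bullet>c u = 1" by simp
    have "u \<notin> B" using ub uu by force
    moreover have "?P (insert u B)"
      using B uQ ub bu uu \<open>u \<notin> B\<close> by (auto simp: orthonormal_def)
    ultimately show False using max[of "insert u B"] fin by simp
  qed
  ultimately have "V.span B = Q" by (simp add: subset_antisym subsetI)
  then have "orthonormal_basis N Q B" unfolding orthonormal_basis_iff[OF Q] using B by simp
  then show ?thesis by (rule that)
qed

text \<open>The vectors satisfying \<open>S\<close> form a submodule containing \<open>B\<close>,
  hence contain its span \<open>Q\<close>. It serves to extend identities that are linear or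
  conjugate-linear in one argument from a basis to \<open>Q\<close>.\<close>

lemma span_induct_cspace:
  assumes Q: "VectorSpace.subspace class_ring Q (cspace N)" and B: "orthonormal_basis N Q B"
    and x: "x \<in> Q"
    and base: "\<And>b. b \<in> B \<Longrightarrow> S b" and zero: "S (0\<^sub>v N)"
    and add: "\<And>v w. v \<in> carrier_vec N \<Longrightarrow> w \<in> carrier_vec N \<Longrightarrow> S v \<Longrightarrow> S w \<Longrightarrow> S (v + w)"
    and smult: "\<And>a v. v \<in> carrier_vec N \<Longrightarrow> S v \<Longrightarrow> S (a \<cdot>\<^sub>v v)"
  shows "S x"
proof -
  have "B \<subseteq> Q" "V.span B = Q" using B orthonormal_basis_iff[OF Q] by auto
  moreover have "submodule class_ring {v \<in> carrier_vec N. S v} (cspace N)"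
    using zero add smult by (intro submodule_cspaceI) auto
  ultimately show ?thesis
    using V.span_is_subset[of B "{v \<in> carrier_vec N. S v}"] base x subspace_cspaceD(1)[OF Q] by blast
qed

section \<open>Uniqueness and existence of the orthogonal projector\<close>

lemma orth_projector_unique:
  assumes "is_orth_projector N Q P" "is_orth_projector N Q R"
  shows "P = R"
proof -
  \<comment> \<open>Each \<open>A *\<^sub>v v\<close> lies in \<open>Q\<close>, the range of
    \<open>B\<close>, and an idempotent fixes its range.\<close>
  have absorb: "B * A = A" if A: "is_orth_projector N Q A" and B: "is_orth_projector N Q B" for A B
  proof (rule eq_mat_mult_vecI)
    show "B * A \<in> carrier_mat N N" "A \<in> carrier_mat N N"
      using A B by (auto simp: is_orth_projector_def)
    fix v :: "complex vec" assume v: "v \<in> carrier_vec N"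
    have "A *\<^sub>v v \<in> Q" using A v by (auto simp: is_orth_projector_def)
    then obtain w where w: "w \<in> carrier_vec N" "A *\<^sub>v v = B *\<^sub>v w"
      using B by (auto simp: is_orth_projector_def)
    have c: "A \<in> carrier_mat N N" "B \<in> carrier_mat N N" "B * B = B"
      using A B by (auto simp: is_orth_projector_def)
    have "(B * A) *\<^sub>v v = B *\<^sub>v (B *\<^sub>v w)" using c v w by simp
    also have "\<dots> = (B * B) *\<^sub>v w" using c w(1) by (metis assoc_mult_mat_vec)
    finally show "(B * A) *\<^sub>v v = A *\<^sub>v v" using c w by simp
  qed
  have c: "P \<in> carrier_mat N N" "R \<in> carrier_mat N N" "mat_adjoint P = P" "mat_adjoint R = R"
    using assms by (auto simp: is_orth_projector_def)
  \<comment> \<open>Absorption gives \<open>R * P = P\<close>; its adjoint reads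
    \<open>P * R = P\<close>, while absorption with the roles exchanged gives
    \<open>P * R = R\<close>.\<close>
  have "P = mat_adjoint (R * P)" using absorb[OF assms] c by simp
  also have "\<dots> = P * R" using mat_adjoint_mult[OF c(2,1)] c by simp
  also have "\<dots> = R" using absorb[OF assms(2,1)] .
  finally show ?thesis .
qed

lemma orth_projector_exists:
  assumes Q: "VectorSpace.subspace class_ring Q (cspace N)"
  obtains P where "is_orth_projector N Q P"
proof -
  note Qc = subspace_cspaceD[OF Q]
  obtain B where basis: "orthonormal_basis N Q B" using orthonormal_basis_exists[OF Q] .
  then have B: "orthonormal B" "B \<subseteq> Q" and span: "V.span B = Q"
    using orthonormal_basis_iff[OF Q] by auto
  have BN: "B \<subseteq> carrier_vec N" using B Qc by auto
  have fin: "finite B" using orthonormal_card B BN by blast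
  \<comment> \<open>This is the sum of the rank-one operators |b><b| over the basis, which sends
    \<open>x\<close> to its orthogonal expansion.\<close>
  define P where "P = mat N N (\<lambda>(i, j). \<Sum>b\<in>B. b $ i * cnj (b $ j))"
  have P: "P \<in> carrier_mat N N" by (simp add: P_def)
  have Pv: "P *\<^sub>v x = V.lincomb (\<lambda>b. x \<bullet>c b) B" if x: "x \<in> carrier_vec N" for x
  proof (rule eq_vecI)
    show "dim_vec (P *\<^sub>v x) = dim_vec (V.lincomb (\<lambda>b. x \<bullet>c b) B)"
      using V.lincomb_dim[OF fin BN] P by simp
    fix i assume "i < dim_vec (V.lincomb (\<lambda>b. x \<bullet>c b) B)"
    then have i: "i < N" using V.lincomb_dim[OF fin BN] by simp
    have "(P *\<^sub>v x) $ i = (\<Sum>j<N. \<Sum>b\<in>B. b $ i * cnj (b $ j) * x $ j)"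
      using i x by (simp add: P_def scalar_prod_def atLeast0LessThan sum_distrib_right)
    also have "\<dots> = (\<Sum>b\<in>B. \<Sum>j<N. b $ i * cnj (b $ j) * x $ j)" by (rule sum.swap)
    also have "\<dots> = (\<Sum>b\<in>B. (x \<bullet>c b) * b $ i)"
    proof (rule sum.cong[OF refl])
      fix b assume "b \<in> B"
      then have "dim_vec b = N" using BN by auto
      then show "(\<Sum>j<N. b $ i * cnj (b $ j) * x $ j) = (x \<bullet>c b) * b $ i"
        by (simp add: scalar_prod_def atLeast0LessThan sum_distrib_left mult_ac)
    qed
    also have "\<dots> = V.lincomb (\<lambda>b. x \<bullet>c b) B $ i" by (rule V.lincomb_index[OF i BN, symmetric])
    finally show "(P *\<^sub>v x) $ i = V.lincomb (\<lambda>b. x \<bullet>c b) B $ i" .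
  qed
  have PQ: "P *\<^sub>v x \<in> Q" if "x \<in> carrier_vec N" for x
    unfolding Pv[OF that] span[symmetric] V.span_def using fin by auto
  \<comment> \<open>By linearity it is enough to treat basis vectors, whose expansion has a single
    nonzero term. Idempotence and the range of \<open>P\<close> both follow from this together with
    \<open>PQ\<close>.\<close>
  have fixQ: "P *\<^sub>v x = x" if "x \<in> Q" for x
  proof (rule span_induct_cspace[OF Q basis that])
    fix b assume b: "b \<in> B"
    then have cb: "b \<in> carrier_vec N" using BN by auto
    show "P *\<^sub>v b = b"
    proof (rule eq_vecI)
      fix i assume "i < dim_vec b"
      then have i: "i < N" using cb by simp
      have "V.lincomb (\<lambda>c. b \<bullet>c c) B $ i = (\<Sum>c\<in>B. (b \<bullet>c c) * c $ i)"
        by (rule V.lincomb_index[OF i BN])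
      also have "\<dots> = (\<Sum>c\<in>B. if c = b then b $ i else 0)"
        using B(1) b by (intro sum.cong refl) (simp add: orthonormal_def)
      also have "\<dots> = b $ i" using fin b by simp
      finally show "(P *\<^sub>v b) $ i = b $ i" by (simp only: Pv[OF cb])
    qed (use P cb in auto)
  next
    show "P *\<^sub>v 0\<^sub>v N = 0\<^sub>v N" using P by (intro eq_vecI) auto
  next
    fix v w :: "complex vec"
    assume "v \<in> carrier_vec N" "w \<in> carrier_vec N" "P *\<^sub>v v = v" "P *\<^sub>v w = w"
    then show "P *\<^sub>v (v + w) = v + w" by (simp add: mult_add_distrib_mat_vec[OF P])
  next
    fix a and v :: "complex vec" assume "v \<in> carrier_vec N" "P *\<^sub>v v = v"
    then show "P *\<^sub>v (a \<cdot>\<^sub>v v) = a \<cdot>\<^sub>v v" by (simp add: mult_mat_vec[OF P])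
  qed
  have "P * P = P"
  proof (rule eq_mat_mult_vecI)
    fix v :: "complex vec" assume "v \<in> carrier_vec N"
    then show "P * P *\<^sub>v v = P *\<^sub>v v" using P fixQ PQ by simp
  qed (use P in auto)
  moreover have "mat_adjoint P = P"
  proof (rule eq_matI)
    fix i j assume "i < dim_row P" "j < dim_col P"
    then have ij: "i < N" "j < N" using P by auto
    show "mat_adjoint P $$ (i, j) = P $$ (i, j)"
      unfolding mat_adjoint_index[OF P ij] using ij by (simp add: P_def mult.commute)
  qed (use P mat_adjoint_carrier[OF P] in auto)
  moreover have "(\<lambda>v. P *\<^sub>v v) ` carrier_vec N = Q"
  proof
    show "(\<lambda>v. P *\<^sub>v v) ` carrier_vec N \<subseteq> Q" using PQ by auto
    show "Q \<subseteq> (\<lambda>v. P *\<^sub>v v) ` carrier_vec N"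
    proof
      fix x assume x: "x \<in> Q"
      show "x \<in> (\<lambda>v. P *\<^sub>v v) ` carrier_vec N"
        using x Qc(1) by (intro image_eqI[of _ _ x]) (auto simp only: fixQ[OF x])
    qed
  qed
  ultimately show ?thesis using that P by (auto simp: is_orth_projector_def)
qed

lemma orth_projector_eq:
  assumes "is_orth_projector N Q P"
  shows "orth_projector N Q = P"
  unfolding orth_projector_def using assms orth_projector_unique by blast

subsection \<open>Detectability\<close>

text \<open>The arguments about \<open>P * E * P\<close> use the projector only through these facts:
  it maps into \<open>Q\<close>, fixes \<open>Q\<close> and moves across the inner product.\<close>

lemma orth_projectorD:
  assumes "is_orth_projector N Q P"
  shows "P \<in> carrier_mat N N" "\<And>x. x \<in> carrier_vec N \<Longrightarrow> P *\<^sub>v x \<in> Q"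
    "\<And>x. x \<in> Q \<Longrightarrow> P *\<^sub>v x = x" "\<And>x. x \<in> Q \<Longrightarrow> x \<in> carrier_vec N"
    "\<And>x y. x \<in> carrier_vec N \<Longrightarrow> y \<in> carrier_vec N \<Longrightarrow> (P *\<^sub>v x) \<bullet>c y = x \<bullet>c (P *\<^sub>v y)"
proof -
  show P: "P \<in> carrier_mat N N" using assms by (simp add: is_orth_projector_def)
  have im: "(\<lambda>v. P *\<^sub>v v) ` carrier_vec N = Q" and idem: "P * P = P" and adj: "mat_adjoint P = P"
    using assms by (auto simp: is_orth_projector_def)
  show "P *\<^sub>v x \<in> Q" if "x \<in> carrier_vec N" for x
    using im that by auto
  show "x \<in> carrier_vec N" if "x \<in> Q" for x
    using im that P by (metis imageE mult_mat_vec_carrier)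
  show "P *\<^sub>v x = x" if "x \<in> Q" for x
  proof -
    obtain y where y: "y \<in> carrier_vec N" "x = P *\<^sub>v y" using im \<open>x \<in> Q\<close> by auto
    have "P *\<^sub>v (P *\<^sub>v y) = (P * P) *\<^sub>v y" using P y(1) by simp
    then show ?thesis using idem y by simp
  qed
  show "(P *\<^sub>v x) \<bullet>c y = x \<bullet>c (P *\<^sub>v y)" if "x \<in> carrier_vec N" "y \<in> carrier_vec N" for x y
    using cscalar_prod_adjoint[OF P that] adj by simp
qed

lemma compression_mult_vec:
  assumes "P \<in> carrier_mat N N" "E \<in> carrier_mat N N" "x \<in> carrier_vec N"
  shows "(P * E * P) *\<^sub>v x = P *\<^sub>v (E *\<^sub>v (P *\<^sub>v x))"
proof -
  have "(P * E * P) *\<^sub>v x = (P * E) *\<^sub>v (P *\<^sub>v x)"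
    using assms by (intro assoc_mult_mat_vec) auto
  also have "\<dots> = P *\<^sub>v (E *\<^sub>v (P *\<^sub>v x))"
    using assms by (intro assoc_mult_mat_vec) auto
  finally show ?thesis .
qed

text \<open>Detectability is defined by the existence of a suitable basis, but the right-hand side
  mentions no basis, so the choice of basis does not matter.\<close>

lemma detectable_iff:
  assumes Q: "VectorSpace.subspace class_ring Q (cspace N)"
    and proj: "is_orth_projector N Q P" and E: "E \<in> carrier_mat N N"
  shows "detectable N Q E \<longleftrightarrow> (\<exists>l. P * E * P = l \<cdot>\<^sub>m P)"
proof -
  note P = orth_projectorD[OF proj]
  note PEP = compression_mult_vec[OF P(1) E]
  show ?thesis
  proof
    assume "detectable N Q E"
    then obtain B where basis: "orthonormal_basis N Q B"
      and eq: "\<forall>v\<in>B. \<forall>w\<in>B. braket v E v = braket w E w"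
      and zero: "\<forall>v\<in>B. \<forall>w\<in>B. v \<noteq> w \<longrightarrow> braket v E w = 0"
      unfolding detectable_def by blast
    have B: "orthonormal B" "B \<subseteq> Q" using orthonormal_basis_iff[OF Q] basis by auto
    \<comment> \<open>The common diagonal value; for empty \<open>B\<close>, that is for
      \<open>Q\<close> zero, any \<open>l\<close> will do.\<close>
    obtain l where l: "\<And>v. v \<in> B \<Longrightarrow> braket v E v = l" using eq by metis
    \<comment> \<open>The diagonal and off-diagonal conditions together say that the forms of
      \<open>E\<close> and of \<open>l\<close> times the identity agree on basis pairs. The next two
      steps extend this to \<open>Q\<close> in one argument at a time.\<close>
    have BB: "(E *\<^sub>v w) \<bullet>c v = l * (w \<bullet>c v)" if "v \<in> B" "w \<in> B" for v w
    proof (cases "v = w")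
      case True
      then show ?thesis using l that B(1) by (simp add: orthonormal_def braket_def)
    next
      case False
      then show ?thesis using zero that B(1) by (simp add: orthonormal_def braket_def)
    qed
    have QB: "(E *\<^sub>v x) \<bullet>c v = l * (x \<bullet>c v)" if v: "v \<in> B" and x: "x \<in> Q" for v x
    proof (rule span_induct_cspace[OF Q basis x])
      have cv: "v \<in> carrier_vec N" using v B P(4) by auto
      show "(E *\<^sub>v b) \<bullet>c v = l * (b \<bullet>c v)" if "b \<in> B" for b using BB v that by simp
      have "E *\<^sub>v 0\<^sub>v N = 0\<^sub>v N" using E by (intro eq_vecI) auto
      then show "(E *\<^sub>v 0\<^sub>v N) \<bullet>c v = l * (0\<^sub>v N \<bullet>c v)" using cv by simp
      show "(E *\<^sub>v (x + y)) \<bullet>c v = l * ((x + y) \<bullet>c v)"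
        if "x \<in> carrier_vec N" "y \<in> carrier_vec N"
          "(E *\<^sub>v x) \<bullet>c v = l * (x \<bullet>c v)" "(E *\<^sub>v y) \<bullet>c v = l * (y \<bullet>c v)" for x y
        using that cv E by (simp add: mult_add_distrib_mat_vec[OF E] add_scalar_prod_distrib[of _ N] distrib_left)
      show "(E *\<^sub>v (a \<cdot>\<^sub>v x)) \<bullet>c v = l * ((a \<cdot>\<^sub>v x) \<bullet>c v)"
        if "x \<in> carrier_vec N" "(E *\<^sub>v x) \<bullet>c v = l * (x \<bullet>c v)" for a x
        using that cv E by (simp add: mult_mat_vec[OF E] smult_scalar_prod_distrib[of _ N])
    qed
    \<comment> \<open>The second argument is conjugate-linear, but conjugated coefficients appear
      equally on both sides, so \<open>l\<close> itself stays unconjugated.\<close>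
    have QQ: "(E *\<^sub>v x) \<bullet>c y = l * (x \<bullet>c y)" if x: "x \<in> Q" and y: "y \<in> Q" for x y
    proof (rule span_induct_cspace[OF Q basis y])
      have cx: "x \<in> carrier_vec N" "E *\<^sub>v x \<in> carrier_vec N" using x P(4) E by auto
      show "(E *\<^sub>v x) \<bullet>c b = l * (x \<bullet>c b)" if "b \<in> B" for b using QB x that by simp
      show "(E *\<^sub>v x) \<bullet>c 0\<^sub>v N = l * (x \<bullet>c 0\<^sub>v N)" using cx by simp
      show "(E *\<^sub>v x) \<bullet>c (v + w) = l * (x \<bullet>c (v + w))"
        if "v \<in> carrier_vec N" "w \<in> carrier_vec N"
          "(E *\<^sub>v x) \<bullet>c v = l * (x \<bullet>c v)" "(E *\<^sub>v x) \<bullet>c w = l * (x \<bullet>c w)" for v w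
        using that cx by (simp add: conjugate_add_vec[of _ N] scalar_prod_add_distrib[of _ N] distrib_left)
      show "(E *\<^sub>v x) \<bullet>c (a \<cdot>\<^sub>v v) = l * (x \<bullet>c (a \<cdot>\<^sub>v v))"
        if "v \<in> carrier_vec N" "(E *\<^sub>v x) \<bullet>c v = l * (x \<bullet>c v)" for a v
        using that cx by (simp add: conjugate_smult_vec)
    qed
    have cPEP: "P * E * P \<in> carrier_mat N N"
      by (rule mult_carrier_mat[OF mult_carrier_mat[OF P(1) E] P(1)])
    have clP: "l \<cdot>\<^sub>m P \<in> carrier_mat N N" using P(1) by simp
    have "P * E * P = l \<cdot>\<^sub>m P"
    proof (rule eq_mat_mult_vecI)
      fix x :: "complex vec" assume x: "x \<in> carrier_vec N"
      show "P * E * P *\<^sub>v x = l \<cdot>\<^sub>m P *\<^sub>v x"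
      proof (rule eq_vec_cscalar_prodI)
        fix y :: "complex vec" assume y: "y \<in> carrier_vec N"
        have Px: "P *\<^sub>v x \<in> Q" "P *\<^sub>v x \<in> carrier_vec N" and Py: "P *\<^sub>v y \<in> Q"
          using P x y by auto
        \<comment> \<open>Moving the outer \<open>P\<close> onto \<open>y\<close> puts both
          arguments in \<open>Q\<close>, where \<open>QQ\<close> applies.\<close>
        have "(P * E * P *\<^sub>v x) \<bullet>c y = (E *\<^sub>v (P *\<^sub>v x)) \<bullet>c (P *\<^sub>v y)"
          unfolding PEP[OF x] using E Px y by (intro P(5)) auto
        also have "\<dots> = l * ((P *\<^sub>v x) \<bullet>c (P *\<^sub>v y))" using QQ Px Py by simp
        \<comment> \<open>The second \<open>P\<close> moves back onto a vector that it already
          fixes.\<close>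
        also have "(P *\<^sub>v x) \<bullet>c (P *\<^sub>v y) = (P *\<^sub>v x) \<bullet>c y"
          using P(5)[OF Px(2) y] P(3)[OF Px(1)] by simp
        also have "l * ((P *\<^sub>v x) \<bullet>c y) = (l \<cdot>\<^sub>m P *\<^sub>v x) \<bullet>c y"
          using P(1) x y Px by (simp add: smult_mat_mult_vec[of _ N N] smult_scalar_prod_distrib[of _ N])
        finally show "(P * E * P *\<^sub>v x) \<bullet>c y = (l \<cdot>\<^sub>m P *\<^sub>v x) \<bullet>c y" .
      qed (rule mult_mat_vec_carrier[OF cPEP x] mult_mat_vec_carrier[OF clP x])+
    qed (rule cPEP clP)+
    then show "\<exists>l. P * E * P = l \<cdot>\<^sub>m P" by blast
  next
    assume "\<exists>l. P * E * P = l \<cdot>\<^sub>m P"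
    then obtain l where l: "P * E * P = l \<cdot>\<^sub>m P" by blast
    obtain B where basis: "orthonormal_basis N Q B" using orthonormal_basis_exists[OF Q] .
    have B: "orthonormal B" "B \<subseteq> Q" using orthonormal_basis_iff[OF Q] basis by auto
    have "braket v E w = l * (w \<bullet>c v)" if "v \<in> B" "w \<in> B" for v w
    proof -
      have v: "v \<in> Q" "v \<in> carrier_vec N" and w: "w \<in> Q" "w \<in> carrier_vec N"
        using that B P(4) by auto
      have "(E *\<^sub>v w) \<bullet>c v = (E *\<^sub>v (P *\<^sub>v w)) \<bullet>c (P *\<^sub>v v)" using P(3) v w by simp
      also have "\<dots> = (P * E * P *\<^sub>v w) \<bullet>c v"
        unfolding PEP[OF w(2)] using E v w P by (intro P(5)[symmetric]) auto
      also have "\<dots> = l * (w \<bullet>c v)"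
        unfolding l using P(1) P(3)[OF w(1)] v w
        by (simp add: smult_mat_mult_vec[of _ N N] smult_scalar_prod_distrib[of _ N])
      finally show ?thesis by (simp add: braket_def)
    qed
    then show "detectable N Q E"
      unfolding detectable_def using basis B(1) by (intro exI[of _ B]) (simp add: orthonormal_def)
  qed
qed

text \<open>Hermiticity makes the quadratic form of \<open>E\<close> real, and
  \<open>E * E = 1\<^sub>m N\<close> makes \<open>E\<close> norm preserving, which bounds the form
  by the squared norm. The conclusion speaks of some \<open>j\<close> and not of \<open>l\<close>,
  since for zero \<open>Q\<close> the scalar \<open>l\<close> is an arbitrary complex
  number.\<close>

lemma compression_eigenvalue_bound:
  assumes proj: "is_orth_projector N Q P" and E: "E \<in> carrier_mat N N"
    and herm: "mat_adjoint E = E" and inv: "E * E = 1\<^sub>m N" and l: "P * E * P = l \<cdot>\<^sub>m P"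
  shows "\<exists>j\<in>{-1..1}. P * E * P = complex_of_real j \<cdot>\<^sub>m P"
proof (cases "Q \<subseteq> {0\<^sub>v N}")
  note P = orth_projectorD[OF proj]
  case True
  have "P = 0\<^sub>m N N"
  proof (rule eq_mat_mult_vecI[OF P(1) zero_carrier_mat])
    fix v :: "complex vec" assume v: "v \<in> carrier_vec N"
    then have "P *\<^sub>v v = 0\<^sub>v N" using True P(2) by blast
    also have "\<dots> = 0\<^sub>m N N *\<^sub>v v" using v by (intro eq_vecI) auto
    finally show "P *\<^sub>v v = 0\<^sub>m N N *\<^sub>v v" .
  qed
  \<comment> \<open>With \<open>P = 0\<close> every scalar satisfies the equation; 0 is one from the
    interval.\<close>
  then show ?thesis using E by (intro bexI[of _ 0]) auto
next
  note P = orth_projectorD[OF proj]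
  case False
  then obtain v where v: "v \<in> Q" "v \<noteq> 0\<^sub>v N" by auto
  have cv: "v \<in> carrier_vec N" using P(4) v by simp
  have cE: "E *\<^sub>v v \<in> carrier_vec N" using E cv by simp
  \<comment> \<open>The vector \<open>v\<close> is not normalised; its squared norm \<open>s\<close>
    is carried along as a positive factor.\<close>
  define s where "s = Re (v \<bullet>c v)"
  have "v \<bullet>c v > 0" using conjugate_square_greater_0_vec[OF cv] v by simp
  then have s: "s > 0" "v \<bullet>c v = complex_of_real s"
    by (auto simp: s_def less_complex_def complex_eq_iff)
  have "(E *\<^sub>v v) \<bullet>c v = (E *\<^sub>v (P *\<^sub>v v)) \<bullet>c (P *\<^sub>v v)" using P(3) v by simp
  also have "\<dots> = (P *\<^sub>v (E *\<^sub>v (P *\<^sub>v v))) \<bullet>c v"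
    using E cv v P by (intro P(5)[symmetric]) auto
  also have "P *\<^sub>v (E *\<^sub>v (P *\<^sub>v v)) = l \<cdot>\<^sub>m P *\<^sub>v v"
    unfolding l[symmetric] by (rule compression_mult_vec[OF P(1) E cv, symmetric])
  also have "\<dots> = l \<cdot>\<^sub>v v" using P(1) P(3)[OF v(1)] cv by (simp add: smult_mat_mult_vec[of _ N N])
  finally have Evv: "(E *\<^sub>v v) \<bullet>c v = l * complex_of_real s" using cv s by simp
  have vEv: "v \<bullet>c (E *\<^sub>v v) = l * complex_of_real s"
    using cscalar_prod_adjoint[OF E cv cv] herm Evv by simp
  have "cnj (l * complex_of_real s) = l * complex_of_real s"
    using cnj_cscalar_prod[OF cE cv] Evv vEv by simp
  then have "cnj l = l" using s by simp
  then obtain j where j: "l = complex_of_real j" by (metis Reals_cases Reals_cnj_iff)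
  have EE: "(E *\<^sub>v v) \<bullet>c (E *\<^sub>v v) = complex_of_real s"
  proof -
    have "(E *\<^sub>v v) \<bullet>c (E *\<^sub>v v) = v \<bullet>c (E *\<^sub>v (E *\<^sub>v v))"
      using cscalar_prod_adjoint[OF E cv cE] herm by simp
    also have "E *\<^sub>v (E *\<^sub>v v) = (E * E) *\<^sub>v v" using E cv by simp
    finally show ?thesis using inv cv s by simp
  qed
  txt \<open>This is \<open>\<parallel>E v + t v\<parallel>\<^sup>2 \<ge> 0\<close>.\<close>
  have "0 \<le> 2 * s + 2 * t * j * s" if t: "t = 1 \<or> t = -1" for t :: real
  proof -
    define c where "c = complex_of_real t"
    let ?u = "E *\<^sub>v v + c \<cdot>\<^sub>v v"
    have cc: "cnj c = c" "c * c = 1" using t by (auto simp: c_def)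
    have cvv: "c \<cdot>\<^sub>v v \<in> carrier_vec N" using cv by simp
    have "?u \<bullet>c ?u = (E *\<^sub>v v) \<bullet>c (E *\<^sub>v v) + c * ((E *\<^sub>v v) \<bullet>c v) + c * (v \<bullet>c (E *\<^sub>v v)) + c * c * (v \<bullet>c v)"
      using cv cE cvv cc by (simp add: conjugate_add_vec[of _ N] scalar_prod_add_distrib[of _ N]
          add_scalar_prod_distrib[of _ N] conjugate_smult_vec distrib_left)
    also have "\<dots> = complex_of_real (2 * s + 2 * t * j * s)"
      unfolding EE Evv vEv cc s j by (simp add: c_def)
    finally have "complex_of_real (2 * s + 2 * t * j * s) \<ge> 0"
      using conjugate_square_ge_0_vec[of ?u] by metis
    then show ?thesis by (simp add: less_eq_complex_def)
  qed
  \<comment> \<open>The two signs of \<open>t\<close> give the two bounds on \<open>j\<close>, once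
    the positive factor \<open>s\<close> is cancelled.\<close>
  from this[of 1] this[of "-1"] have "0 \<le> s * (1 + j)" "0 \<le> s * (1 - j)"
    by (auto simp: algebra_simps)
  then have "j \<in> {-1..1}" using s(1) by (simp add: zero_le_mult_iff)
  then show ?thesis using l j by blast
qed

end

section \<open>Undetectable errors and the distance\<close>

lemma detectable_iff_gs_set:
  assumes Q: "VectorSpace.subspace class_ring Q (cspace (2 ^ (n + c)))" and \<alpha>: "\<alpha> \<in> pauli_ops n"
  shows "detectable (2 ^ (n + c)) Q (\<alpha> \<otimes>\<^sub>k 1\<^sub>m (2 ^ c)) \<longleftrightarrow> \<alpha> \<in> (\<Union>j\<in>{-1..1}. gs_set n c Q j)"
proof -
  obtain P where P: "is_orth_projector (2 ^ (n + c)) Q P" using orth_projector_exists[OF Q] .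
  note E = pauli_ops_kron_one[OF \<alpha>, of c]
  \<comment> \<open>From left to right the complex scalar must be replaced by a real one in the
    index range, which is the eigenvalue bound; from right to left the index \<open>j\<close> is
    itself a scalar.\<close>
  show ?thesis
    using detectable_iff[OF Q P E(1)] compression_eigenvalue_bound[OF P E] \<alpha>
    unfolding gs_set_def Let_def orth_projector_eq[OF P] by blast
qed

theorem lemma18:
  fixes n M d c :: nat and Q :: "complex vec set"
  assumes "ea_code n M d c Q"
  shows "pauli_ops n - (\<Union>j\<in>{-1..1}. gs_set n c Q j) \<noteq> {} \<and>
    d = Min {wt \<alpha> | \<alpha>. \<alpha> \<in> pauli_ops n - (\<Union>j\<in>{-1..1}. gs_set n c Q j)}"
proof -
  let ?U = "pauli_ops n - (\<Union>j\<in>{-1..1}. gs_set n c Q j)"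
  let ?det = "\<lambda>\<alpha>. detectable (2 ^ (n + c)) Q (\<alpha> \<otimes>\<^sub>k 1\<^sub>m (2 ^ c))"
  have Q: "VectorSpace.subspace class_ring Q (cspace (2 ^ (n + c)))"
    and low: "\<And>\<alpha>. \<alpha> \<in> pauli_ops n \<Longrightarrow> int (wt \<alpha>) \<le> int d - 1 \<Longrightarrow> ?det \<alpha>"
    and "\<exists>\<alpha>\<in>pauli_ops n. wt \<alpha> = d \<and> \<not> ?det \<alpha>"
    using assms unfolding ea_code_def by blast+
  \<comment> \<open>The failure of detectability at weight \<open>d\<close>, demanded of a code,
    supplies the element attaining the minimum and shows the set nonempty.\<close>
  then obtain \<alpha> where \<alpha>: "\<alpha> \<in> ?U" "wt \<alpha> = d"
    using detectable_iff_gs_set[OF Q] by blast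
  \<comment> \<open>Contrapositive of detectability below \<open>d\<close>. The bound in
    \<open>low\<close> is over the integers, so for \<open>d = 0\<close> it is vacuous, whereas
    truncated subtraction would include weight 0.\<close>
  have ge: "d \<le> wt \<beta>" if "\<beta> \<in> ?U" for \<beta>
    using low[of \<beta>] detectable_iff_gs_set[OF Q, of \<beta>] that by force
  \<comment> \<open>\<open>Min\<close> is meaningful only on finite nonempty sets. Finiteness comes
    from there being finitely many Pauli operators; nonemptiness is part of the conclusion.\<close>
  have "finite {wt \<alpha> | \<alpha>. \<alpha> \<in> ?U}"
    using finite_pauli_ops[of n] by (simp add: Setcompr_eq_image)
  then have "Min {wt \<alpha> | \<alpha>. \<alpha> \<in> ?U} = d"
    using \<alpha> ge by (intro Min_eqI) auto
  then show ?thesis using \<alpha> by blast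
qed

end
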